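(* Let $a<b$ be real numbers, let $k\ge 0$ be an integer, and let $f:[a,b]\to\mathbb{R}$ be a function such that $f^{(k)}$ is of bounded variation on $[a,b]$, with total variation $V_k=\mathrm{Var}(f^{(k)})<\infty$. Let $c_j$ be the Chebyshev coefficients of $f$ on $[a,b]$ and let $$c_j^{(k)}=\frac{2}{\pi}\int_0^\pi f^{(k)}(\mathsf{G}(\cos\theta))\cos(j\theta)\,d\theta .$$ Then $$|c_j^{(k)}|\le\frac{2V_k}{j\pi}\qquad\text{for } j=1,2,\ldots,$$ and $$|c_j|\le\frac{2V_k}{\pi}\left(\frac{b-a}{4}\right)^k\sum_{i=0}^{k}\binom{k}{i}\frac{1}{(j+i)(j+i-1)\cdots(j+i-k)}\qquad\text{for } j=k+1,k+2,\ldots.$$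
   Context: The map $\mathsf{G}:[-1,1]\to[a,b]$ is the bijection $\mathsf{G}(t)=a+\frac{b-a}{2}(t+1)$. The Chebyshev coefficients of $f:[a,b]\to\mathbb{R}$ are $$c_j=\frac{2}{\pi}\int_0^\pi f(\mathsf{G}(\cos\theta))\cos(j\theta)\,d\theta,\qquad j=0,1,2,\ldots,$$ so that $c_j^{(0)}=c_j$. Derivatives are understood in the weak (distributional) sense where classical derivatives fail to exist: for $k\ge1$, $f,f',\ldots,f^{(k-1)}$ are absolutely continuous on $[a,b]$ and $f^{(k)}$ is a function of bounded variation on $[a,b]$ with $f^{(k-1)}(y)-f^{(k-1)}(x)=\int_x^y f^{(k)}(u)\,du$ for all $x,y\in[a,b]$. For $k=0$, $f^{(0)}=f$. The product $(j+i)(j+i-1)\cdots(j+i-k)$ has $k+1$ factors. *)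

theory Defs
  imports "HOL-Analysis.Analysis"
begin

definition variation_sums :: "(real \<Rightarrow> real) \<Rightarrow> real \<Rightarrow> real \<Rightarrow> real set" where
  "variation_sums g a b =
     {\<Sum>i<n. \<bar>g (x (Suc i)) - g (x i)\<bar> | (n :: nat) (x :: nat \<Rightarrow> real).
        x 0 = a \<and> x n = b \<and> (\<forall>i<n. x i < x (Suc i))}"

definition bounded_variation :: "(real \<Rightarrow> real) \<Rightarrow> real \<Rightarrow> real \<Rightarrow> bool" where
  "bounded_variation g a b \<longleftrightarrow> bdd_above (variation_sums g a b)"

text \<open>Only meaningful when \<^term>\<open>bounded_variation g a b\<close> holds, since the supremum is
  taken in \<^typ>\<open>real\<close>.\<close>

definition total_variation :: "(real \<Rightarrow> real) \<Rightarrow> real \<Rightarrow> real \<Rightarrow> real" where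
  "total_variation g a b = Sup (variation_sums g a b)"

text \<open>In one dimension, the members of a division are non-overlapping compact intervals
  (possibly single points, which contribute nothing to either sum).\<close>

definition absolutely_continuous_fun :: "(real \<Rightarrow> real) \<Rightarrow> real \<Rightarrow> real \<Rightarrow> bool" where
  "absolutely_continuous_fun g a b \<longleftrightarrow>
     (\<forall>\<epsilon>>0. \<exists>\<delta>>0. \<forall>d t. d division_of t \<longrightarrow> t \<subseteq> {a..b} \<longrightarrow> (\<Sum>I\<in>d. Sup I - Inf I) < \<delta> \<longrightarrow>
        (\<Sum>I\<in>d. \<bar>g (Sup I) - g (Inf I)\<bar>) < \<epsilon>)"

definition weak_derivative :: "real \<Rightarrow> real \<Rightarrow> (real \<Rightarrow> real) \<Rightarrow> (real \<Rightarrow> real) \<Rightarrow> bool" where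
  "weak_derivative a b g g' \<longleftrightarrow>
     absolutely_continuous_fun g a b \<and>
     (\<forall>x y. a \<le> x \<longrightarrow> x \<le> y \<longrightarrow> y \<le> b \<longrightarrow> (g' has_integral (g y - g x)) {x..y})"

text \<open>Here \<^term>\<open>D i\<close> is the \<open>i\<close>-th derivative. Those of order \<open>1,\<dots>,k-1\<close> are themselves
  absolutely continuous and hence classical derivatives (lemma \<open>weak_derivative_classical\<close>);
  only the last one, \<^term>\<open>g\<close>, is determined merely up to a null set.\<close>

definition kth_derivative :: "real \<Rightarrow> real \<Rightarrow> nat \<Rightarrow> (real \<Rightarrow> real) \<Rightarrow> (real \<Rightarrow> real) \<Rightarrow> bool" where
  "kth_derivative a b k f g \<longleftrightarrow>
     (\<exists>D :: nat \<Rightarrow> real \<Rightarrow> real.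
        (\<forall>x\<in>{a..b}. D 0 x = f x) \<and> (\<forall>x\<in>{a..b}. D k x = g x) \<and>
        (\<forall>i<k. weak_derivative a b (D i) (D (Suc i))))"

lemma weak_derivative_classical:
  assumes w: "weak_derivative a b g g'" and c: "continuous_on {a..b} g'" and x: "x \<in> {a..b}"
  shows "(g has_real_derivative g' x) (at x within {a..b})"
proof -
  have "((\<lambda>u. integral {a..u} g') has_vector_derivative g' x) (at x within {a..b})"
    by (rule integral_has_vector_derivative[OF c x])
  then have d: "((\<lambda>u. g a + integral {a..u} g') has_vector_derivative g' x) (at x within {a..b})"
    by (auto intro!: derivative_eq_intros)
  have e: "g u = g a + integral {a..u} g'" if "u \<in> {a..b}" for u
  proof -
    have "(g' has_integral (g u - g a)) {a..u}"
      using w that unfolding weak_derivative_def by auto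
    then show ?thesis by (simp add: integral_unique)
  qed
  have "(g has_vector_derivative g' x) (at x within {a..b})"
    by (rule has_vector_derivative_transform[OF x e d])
  then show ?thesis by (simp add: has_real_derivative_iff_has_vector_derivative)
qed

definition cheb_map :: "real \<Rightarrow> real \<Rightarrow> real \<Rightarrow> real" where
  "cheb_map a b t = a + (b - a) / 2 * (t + 1)"

definition cheb_coeff :: "real \<Rightarrow> real \<Rightarrow> (real \<Rightarrow> real) \<Rightarrow> nat \<Rightarrow> real" where
  "cheb_coeff a b g j =
     2 / pi * integral {0..pi} (\<lambda>\<theta>. g (cheb_map a b (cos \<theta>)) * cos (real j * \<theta>))"

end

theory Submission
  imports Defs
begin

text \<open>
  A function of bounded variation is a difference \<open>p - n\<close> of increasing functions whose total
  increments add up to the variation. The second mean value theorem applied to \<open>p\<close> and \<open>n\<close> against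
  \<open>cos (j \<theta>)\<close> leaves only a value of \<open>sin (j \<theta>) / j\<close>, which gives the bound for the top derivative.
  Integration by parts together with \<open>2 sin \<theta> sin (j \<theta>) = cos ((j-1) \<theta>) - cos ((j+1) \<theta>)\<close> gives
  \<open>c\<^sub>j(F) = (b-a)/(4j) (c\<^sub>j\<^sub>-\<^sub>1(F') - c\<^sub>j\<^sub>+\<^sub>1(F'))\<close>. It is legitimate although \<open>F'\<close> may have
  infinitely many jumps, since these are countably many. Iterating the recurrence, the weights
  in the bound close up exactly: \<open>S\<^sub>m(j-1) + S\<^sub>m(j+1) = j S\<^sub>m\<^sub>+\<^sub>1(j)\<close>.
\<close>

section \<open>Monotonicity and the fundamental theorem of calculus with countably many exceptional
  points\<close>

lemma nonneg_derivative_off_countable_imp_le: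
  fixes f :: "real \<Rightarrow> real"
  assumes "a \<le> b" and S: "countable S" and cont: "continuous_on {a..b} f"
    and der: "\<And>x. x \<in> {a<..<b} - S \<Longrightarrow> \<exists>D\<ge>0. (f has_real_derivative D) (at x)"
  shows "f a \<le> f b"
proof (cases "a = b")
  txt \<open>Tilt \<open>f\<close> by a small slope, choose a level \<open>c\<close> that is not taken on \<open>S\<close>, and look at the last
    point where the tilted function is at least \<open>c\<close>.\<close>
  case False
  then have "a < b" using \<open>a \<le> b\<close> by simp
  show ?thesis
  proof (rule ccontr)
    assume neg: "\<not> f a \<le> f b"
    \<comment> \<open>Half the mean rate of fall of \<open>f\<close>: tilting by this slope closes
      only half of the gap, so \<open>h\<close> still falls from \<open>a\<close> to
      \<open>b\<close>.\<close>
    define e where "e = (f a - f b) / (2 * (b - a))"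
    have "e > 0" using neg \<open>a < b\<close> by (simp add: e_def)
    define h where "h x = f x + e * (x - a)" for x
    have conth: "continuous_on {a..b} h"
      unfolding h_def by (intro continuous_intros cont)
    have "e * (b - a) = (f a - f b) / 2"
      using \<open>a < b\<close> by (simp add: e_def field_simps)
    then have hab: "h b < h a" using neg by (simp add: h_def)
    have "uncountable ({h b<..<h a} - h ` S)"
      using hab S uncountable_open_interval[of "h b" "h a"]
      by (simp add: uncountable_minus_countable)
    then have "{h b<..<h a} - h ` S \<noteq> {}" by (metis countable_empty)
    then obtain c where c: "h b < c" "c < h a" "c \<notin> h ` S" by fastforce
    define A where "A = {x \<in> {a..b}. c \<le> h x}"
    have "closed A"
      unfolding A_def by (intro continuous_on_closed_Collect_le conth continuous_intros)
    moreover have "a \<in> A" "bdd_above A"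
      using c \<open>a < b\<close> by (auto simp: A_def intro: bdd_aboveI[of _ b])
    ultimately have sA: "Sup A \<in> A"
      by (intro closed_contains_Sup) auto
    define s where "s = Sup A"
    have s: "a \<le> s" "s \<le> b" "c \<le> h s" using sA by (auto simp: A_def s_def)
    have above: "h x < c" if "s < x" "x \<le> b" for x
    proof (rule ccontr)
      assume "\<not> h x < c"
      then have "x \<in> A" using that s by (auto simp: A_def)
      then have "x \<le> s" using \<open>bdd_above A\<close> by (simp add: s_def cSup_upper)
      with that show False by simp
    qed
    have "s < b" using s c by (cases "s = b") auto
    have "h s \<le> c"
    proof (rule ccontr)
      assume n: "\<not> h s \<le> c"
      have "continuous_on {s..b} h" using conth s by (auto intro: continuous_on_subset)
      then obtain x where x: "s \<le> x" "x \<le> b" "h x = c"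
        using IVT2'[of h b c s] n c \<open>s < b\<close> by auto
      then show False using above[of x] n by (cases "x = s") auto
    qed
    then have hs: "h s = c" using s by simp
    then have "s \<noteq> a" "s \<notin> S" using c by auto
    then obtain D where D: "D \<ge> 0" "(f has_real_derivative D) (at s)"
      using der[of s] s \<open>s < b\<close> by auto
    \<comment> \<open>Since \<open>D\<close> may be zero, it is the tilt that makes this slope
      strictly positive. Hence \<open>h\<close> exceeds \<open>c\<close> just to the right of
      \<open>s\<close>, against \<open>above\<close>.\<close>
    have "(h has_real_derivative D + e) (at s)"
      unfolding h_def by (auto intro!: derivative_eq_intros D)
    from DERIV_pos_inc_right[OF this] D \<open>e > 0\<close>
    obtain d where d: "d > 0" "\<And>x. x > 0 \<Longrightarrow> x < d \<Longrightarrow> h s < h (s + x)"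
      by auto
    define x where "x = min (d / 2) (b - s)"
    have "0 < x" "x < d" "s + x \<le> b" using d \<open>s < b\<close> by (auto simp: x_def)
    then show False using d(2)[of x] above[of "s + x"] hs by auto
  qed
qed simp

lemma zero_derivative_off_countable_imp_eq:
  fixes f :: "real \<Rightarrow> real"
  assumes "a \<le> b" "countable S" "continuous_on {a..b} f"
    and der: "\<And>x. x \<in> {a<..<b} - S \<Longrightarrow> (f has_real_derivative 0) (at x)"
  shows "f a = f b"
proof (rule antisym)
  show "f a \<le> f b"
    using der by (intro nonneg_derivative_off_countable_imp_le[OF assms(1,2,3)]) blast
  have "- f a \<le> - f b"
    using DERIV_minus[OF der]
    by (intro nonneg_derivative_off_countable_imp_le[OF assms(1,2)] continuous_intros assms(3)) force
  then show "f b \<le> f a" by simp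
qed

lemma indefinite_integral_has_real_derivative_at:
  fixes w :: "real \<Rightarrow> real"
  assumes "w integrable_on {a..b}" "x \<in> {a<..<b}" "isCont w x"
  shows "((\<lambda>t. integral {a..t} w) has_real_derivative w x) (at x)"
proof -
  have "((\<lambda>t. integral {a..t} w) has_vector_derivative w x) (at x within {a..b} - {})"
    using assms by (intro integral_has_vector_derivative_continuous_at)
      (auto intro: continuous_at_imp_continuous_at_within)
  moreover have "at x within {a..b} - {} = at x"
    using assms by (intro at_within_interior) (auto simp: interior_atLeastAtMost_real)
  ultimately show ?thesis
    by (simp add: has_real_derivative_iff_has_vector_derivative)
qed

text \<open>The indefinite integral of \<open>w\<close> is differentiable wherever \<open>w\<close>
  is continuous, so \<open>F\<close> minus this integral is continuous with derivative zero off
  \<open>S\<close> and takes equal values at the ends.\<close>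

lemma fundamental_theorem_of_calculus_countable:
  fixes F w :: "real \<Rightarrow> real"
  assumes "a \<le> b" "countable S" and cont: "continuous_on {a..b} F"
    and der: "\<And>x. x \<in> {a<..<b} - S \<Longrightarrow> (F has_real_derivative w x) (at x)"
    and contw: "\<And>x. x \<in> {a<..<b} - S \<Longrightarrow> isCont w x"
    and int: "w integrable_on {a..b}"
  shows "(w has_integral (F b - F a)) {a..b}"
proof -
  define H where "H t = F t - integral {a..t} w" for t
  have "H a = H b"
  proof (rule zero_derivative_off_countable_imp_eq[OF assms(1,2)])
    show "continuous_on {a..b} H"
      unfolding H_def by (intro continuous_intros cont indefinite_integral_continuous_1 int)
    show "(H has_real_derivative 0) (at x)" if "x \<in> {a<..<b} - S" for x
      unfolding H_def using DERIV_diff[OF der[OF that]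
        indefinite_integral_has_real_derivative_at[OF int _ contw[OF that]]] that by simp
  qed
  then have "integral {a..b} w = F b - F a" by (simp add: H_def)
  with int show ?thesis by (metis integrable_integral)
qed

section \<open>Bounded variation and the Jordan decomposition\<close>

text \<open>The points of a division increase from \<open>a\<close> to \<open>b\<close>, so only
  values on \<open>{a..b}\<close> enter the sums.\<close>

lemma variation_sums_cong:
  assumes "\<And>x. x \<in> {a..b} \<Longrightarrow> g x = h x"
  shows "variation_sums g a b = variation_sums h a b"
proof -
  have eq: "(\<Sum>i<n. \<bar>g (x (Suc i)) - g (x i)\<bar>) = (\<Sum>i<n. \<bar>h (x (Suc i)) - h (x i)\<bar>)"
    if x: "x 0 = a" "x n = b" "\<forall>i<n. x i < x (Suc i)" for n and x :: "nat \<Rightarrow> real"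
  proof -
    have le: "x i \<le> x j" if "i \<le> j" "j \<le> n" for i j
      using that
    proof (induction j rule: dec_induct)
      case (step m)
      then have "x i \<le> x m" "x m < x (Suc m)" using x(3) by auto
      then show ?case by simp
    qed simp
    have "x i \<in> {a..b}" if "i \<le> n" for i
      using le[of 0 i] le[of i n] that x(1,2) by simp
    then show ?thesis by (intro sum.cong) (auto simp: assms)
  qed
  then show ?thesis unfolding variation_sums_def by (intro Collect_cong iff_exI) (auto simp: eq)
qed

text \<open>A strictly increasing chain from \<open>a\<close> to \<open>a\<close> has no steps and
  gives the empty sum. Thus the variation starts from zero at the left endpoint.\<close>

lemma variation_sums_refl: "variation_sums g a a = {0}"
proof -
  have n0: "n = 0" if "x 0 = a" "x n = a" "\<forall>i<n. x i < x (Suc i)" for n and x :: "nat \<Rightarrow> real"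
  proof (rule ccontr)
    assume "n \<noteq> 0"
    moreover have "x 0 < x m" if "0 < m" "m \<le> n" for m
      using that \<open>\<forall>i<n. x i < x (Suc i)\<close>
    proof (induction m)
      case (Suc m)
      then show ?case by (cases "m = 0") (auto intro: less_trans)
    qed simp
    ultimately have "x 0 < x n" by blast
    with that show False by simp
  qed
  have "s = 0" if sums: "s \<in> variation_sums g a a" for s
  proof -
    obtain n and x :: "nat \<Rightarrow> real" where s: "s = (\<Sum>i<n. \<bar>g (x (Suc i)) - g (x i)\<bar>)"
      and x: "x 0 = a" "x n = a" "\<forall>i<n. x i < x (Suc i)"
      using sums unfolding variation_sums_def by blast
    show ?thesis using n0[OF x] s by simp
  qed
  moreover have "0 \<in> variation_sums g a a"
    unfolding variation_sums_def by (intro CollectI exI[of _ 0] exI[of _ "\<lambda>_. a"]) simp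
  ultimately show ?thesis by blast
qed

lemma variation_sums_nonempty:
  assumes "a \<le> b"
  shows "variation_sums g a b \<noteq> {}"
proof (cases "a = b")
  case False
  with assms have "\<bar>g b - g a\<bar> \<in> variation_sums g a b"
    unfolding variation_sums_def
    by (intro CollectI exI[of _ 1] exI[of _ "\<lambda>i. if i = 0 then a else b"]) auto
  then show ?thesis by blast
qed (simp add: variation_sums_refl)

text \<open>The point \<open>y\<close> is appended to a division that ends in \<open>x\<close>;
  \<open>x < y\<close> keeps it strictly increasing.\<close>

lemma variation_sums_extend:
  assumes "s \<in> variation_sums g a x" "x < y"
  shows "s + \<bar>g y - g x\<bar> \<in> variation_sums g a y"
proof -
  obtain n p where p: "s = (\<Sum>i<n. \<bar>g (p (Suc i)) - g (p i)\<bar>)"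
    "p 0 = a" "p n = x" "\<forall>i<n. p i < p (Suc i)"
    using assms(1) unfolding variation_sums_def by auto
  have "(\<Sum>i<n. \<bar>g ((p(Suc n := y)) (Suc i)) - g ((p(Suc n := y)) i)\<bar>) = s"
    unfolding p(1) by (intro sum.cong) auto
  then show ?thesis
    using p assms(2) unfolding variation_sums_def
    by (intro CollectI exI[of _ "Suc n"] exI[of _ "p(Suc n := y)"]) (auto simp: less_Suc_eq)
qed

lemma bounded_variation_subinterval:
  assumes "bounded_variation g a b" "x \<le> b"
  shows "bounded_variation g a x"
proof (cases "x = b")
  case False
  obtain M where M: "\<And>s. s \<in> variation_sums g a b \<Longrightarrow> s \<le> M"
    using assms(1) unfolding bounded_variation_def bdd_above_def by blast
  show ?thesis
    unfolding bounded_variation_def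
  proof (rule bdd_aboveI)
    fix s assume "s \<in> variation_sums g a x"
    then have "s + \<bar>g b - g x\<bar> \<le> M"
      using False assms(2) by (intro M variation_sums_extend) auto
    then show "s \<le> M" by linarith
  qed
qed (use assms in simp)

text \<open>This inequality is what makes both variation plus \<open>g\<close> and variation minus
  \<open>g\<close> increasing.\<close>

lemma total_variation_increment:
  assumes "bounded_variation g a b" "a \<le> x" "x \<le> y" "y \<le> b"
  shows "total_variation g a x + \<bar>g y - g x\<bar> \<le> total_variation g a y"
proof (cases "x = y")
  case False
  have "total_variation g a x \<le> total_variation g a y - \<bar>g y - g x\<bar>"
    unfolding total_variation_def
  proof (rule cSup_least[OF variation_sums_nonempty[OF assms(2)]])
    fix s assume "s \<in> variation_sums g a x"
    then have "s + \<bar>g y - g x\<bar> \<in> variation_sums g a y"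
      using False assms by (intro variation_sums_extend) auto
    then have "s + \<bar>g y - g x\<bar> \<le> Sup (variation_sums g a y)"
      using bounded_variation_subinterval[OF assms(1,4)]
      by (intro cSup_upper) (auto simp: bounded_variation_def)
    then show "s \<le> Sup (variation_sums g a y) - \<bar>g y - g x\<bar>" by simp
  qed
  then show ?thesis by simp
qed simp

text \<open>With \<open>V x\<close> the variation on \<open>{a..x}\<close>, the parts are
  \<open>(V + g) / 2\<close> and \<open>(V - g) / 2\<close>. As \<open>V\<close> cancels in the
  difference, \<open>g = p - n\<close> holds on the whole line; as \<open>V a\<close> is zero, the
  increments add up to \<open>V b\<close>.\<close>

lemma Jordan_decomposition:
  assumes bv: "bounded_variation g a b" and "a \<le> b"
  obtains p n where "mono_on {a..b} p" "mono_on {a..b} n" "\<And>x. g x = p x - n x"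
    "(p b - p a) + (n b - n a) = total_variation g a b"
proof
  let ?V = "total_variation g a"
  show "mono_on {a..b} (\<lambda>x. (?V x + g x) / 2)" "mono_on {a..b} (\<lambda>x. (?V x - g x) / 2)"
    using total_variation_increment[OF bv] by (fastforce intro!: mono_onI simp: abs_le_iff)+
  show "((?V b + g b) / 2 - (?V a + g a) / 2) + ((?V b - g b) / 2 - (?V a - g a) / 2) = ?V b"
    by (simp add: total_variation_def variation_sums_refl field_simps)
qed (simp add: field_simps)

section \<open>The Chebyshev substitution and the bound for the top derivative\<close>

lemma cheb_map_endpoints [simp]: "cheb_map a b 1 = b" "cheb_map a b (- 1) = a"
  by (simp_all add: cheb_map_def field_simps)

lemma cheb_map_mono:
  assumes "a \<le> b" "s \<le> t"
  shows "cheb_map a b s \<le> cheb_map a b t"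
  using assms by (simp add: cheb_map_def mult_left_mono)

lemma cheb_map_in_interval:
  assumes "a \<le> b"
  shows "cheb_map a b (cos \<theta>) \<in> {a..b}"
  using cheb_map_mono[OF assms, of "-1" "cos \<theta>"] cheb_map_mono[OF assms, of "cos \<theta>" 1] by simp

lemma cheb_map_in_interior:
  assumes "a < b" "\<theta> \<in> {0<..<pi}"
  shows "cheb_map a b (cos \<theta>) \<in> {a<..<b}"
proof -
  have "cos \<theta> < 1" "-1 < cos \<theta>"
    using assms cos_monotone_0_pi[of 0 \<theta>] cos_monotone_0_pi[of \<theta> pi] by auto
  then have "0 < (b - a) / 2 * (cos \<theta> + 1)" "(b - a) / 2 * (cos \<theta> + 1) < (b - a) / 2 * 2"
    using assms by (intro mult_pos_pos mult_strict_left_mono; simp)+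
  then show ?thesis unfolding cheb_map_def by simp
qed

lemma cheb_coeff_cong:
  assumes "a \<le> b" "\<And>x. x \<in> {a..b} \<Longrightarrow> g x = h x"
  shows "cheb_coeff a b g j = cheb_coeff a b h j"
  unfolding cheb_coeff_def using assms(2)[OF cheb_map_in_interval[OF assms(1)]] by simp

lemma has_integral_cos_multiple:
  assumes "j \<ge> (1::nat)" "x \<le> y"
  shows "((\<lambda>\<theta>. cos (real j * \<theta>)) has_integral (sin (real j * y) / j - sin (real j * x) / j)) {x..y}"
  using assms by (intro fundamental_theorem_of_calculus)
    (auto intro!: derivative_eq_intros simp flip: has_real_derivative_iff_has_vector_derivative)

text \<open>The cosine decreases on \<open>{0..pi}\<close>, so \<open>p\<close> is negated to obtain
  an increasing function for the second mean value theorem. The angles \<open>0\<close> and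
  \<open>pi\<close> are sent to \<open>b\<close> and \<open>a\<close>.\<close>

lemma mono_second_mean_value_cheb:
  fixes p w :: "real \<Rightarrow> real"
  assumes "a \<le> b" and p: "mono_on {a..b} p" and "w integrable_on {0..pi}"
  obtains c where "c \<in> {0..pi}"
    "((\<lambda>\<theta>. p (cheb_map a b (cos \<theta>)) * w \<theta>) has_integral
       (p b * integral {0..c} w + p a * integral {c..pi} w)) {0..pi}"
proof -
  let ?q = "\<lambda>\<theta>. - p (cheb_map a b (cos \<theta>))"
  have "?q s \<le> ?q t" if "0 \<le> s" "s \<le> t" "t \<le> pi" for s t
  proof -
    have "cos t \<le> cos s" using that by (intro cos_monotone_0_pi_le) auto
    from mono_onD[OF p cheb_map_in_interval cheb_map_in_interval cheb_map_mono[OF _ this]] assms(1)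
    show ?thesis by simp
  qed
  then obtain c where c: "c \<in> {0..pi}"
    and I: "((\<lambda>\<theta>. ?q \<theta> * w \<theta>) has_integral (?q 0 * integral {0..c} w + ?q pi * integral {c..pi} w)) {0..pi}"
    using second_mean_value_theorem_full[OF assms(3) pi_ge_zero, of ?q] by blast
  from has_integral_neg[OF I] show thesis
    by (intro that[OF c]) (simp add: add.commute)
qed

text \<open>The second mean value theorem yields integrability of the product along with its
  value.\<close>

lemma mono_cheb_integrable:
  fixes p w :: "real \<Rightarrow> real"
  assumes "a \<le> b" "mono_on {a..b} p" "w integrable_on {0..pi}"
  shows "(\<lambda>\<theta>. p (cheb_map a b (cos \<theta>)) * w \<theta>) integrable_on {0..pi}"
  by (rule mono_second_mean_value_cheb[OF assms]) (rule has_integral_integrable)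

lemma mono_cheb_integral_bound:
  assumes "a \<le> b" "mono_on {a..b} p" "j \<ge> 1"
  shows "\<bar>integral {0..pi} (\<lambda>\<theta>. p (cheb_map a b (cos \<theta>)) * cos (real j * \<theta>))\<bar> \<le> (p b - p a) / j"
proof -
  have w: "(\<lambda>\<theta>. cos (real j * \<theta>)) integrable_on {0..pi}"
    by (intro integrable_continuous_interval continuous_intros)
  obtain c where c: "c \<in> {0..pi}" and I:
    "((\<lambda>\<theta>. p (cheb_map a b (cos \<theta>)) * cos (real j * \<theta>)) has_integral
       (p b * integral {0..c} (\<lambda>\<theta>. cos (real j * \<theta>)) + p a * integral {c..pi} (\<lambda>\<theta>. cos (real j * \<theta>)))) {0..pi}"
    using mono_second_mean_value_cheb[OF assms(1,2) w] by blast
  \<comment> \<open>The sine vanishes at \<open>0\<close> and \<open>j * pi\<close>, so the two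
    integrals are opposite and only the increment \<open>p b - p a\<close> survives.\<close>
  have "integral {0..c} (\<lambda>\<theta>. cos (real j * \<theta>)) = sin (real j * c) / j"
    "integral {c..pi} (\<lambda>\<theta>. cos (real j * \<theta>)) = - sin (real j * c) / j"
    using has_integral_cos_multiple[OF assms(3), of 0 c] has_integral_cos_multiple[OF assms(3), of c pi] c
    by (auto simp: integral_unique)
  with I have "integral {0..pi} (\<lambda>\<theta>. p (cheb_map a b (cos \<theta>)) * cos (real j * \<theta>))
      = (p b - p a) * sin (real j * c) / j"
    by (simp add: integral_unique left_diff_distrib diff_divide_distrib)
  moreover have "p a \<le> p b" using mono_onD[OF assms(2), of a b] assms(1) by simp
  then have "\<bar>(p b - p a) * sin (real j * c)\<bar> \<le> p b - p a"
    using mult_left_mono[OF abs_sin_le_one, of "p b - p a"] by (simp add: abs_mult)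
  ultimately show ?thesis by (simp add: divide_right_mono)
qed

lemma bounded_variation_cheb_integrable:
  assumes "a \<le> b" "bounded_variation g a b" "w integrable_on {0..pi}"
  shows "(\<lambda>\<theta>. g (cheb_map a b (cos \<theta>)) * w \<theta>) integrable_on {0..pi}"
proof -
  obtain p n where pn: "mono_on {a..b} p" "mono_on {a..b} n" "\<And>x. g x = p x - n x"
    using Jordan_decomposition[OF assms(2,1)] by metis
  have "(\<lambda>\<theta>. p (cheb_map a b (cos \<theta>)) * w \<theta>) integrable_on {0..pi}"
    "(\<lambda>\<theta>. n (cheb_map a b (cos \<theta>)) * w \<theta>) integrable_on {0..pi}"
    by (intro mono_cheb_integrable assms(1,3) pn)+
  from integrable_diff[OF this] show ?thesis
    by (simp add: pn(3) left_diff_distrib)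
qed

lemma bounded_variation_cheb_coeff_bound:
  assumes "a \<le> b" "bounded_variation g a b" "j \<ge> 1"
  shows "\<bar>cheb_coeff a b g j\<bar> \<le> 2 * total_variation g a b / (real j * pi)"
proof -
  obtain p n where pn: "mono_on {a..b} p" "mono_on {a..b} n" "\<And>x. g x = p x - n x"
    "(p b - p a) + (n b - n a) = total_variation g a b"
    using Jordan_decomposition[OF assms(2,1)] by metis
  let ?w = "\<lambda>\<theta>. cos (real j * \<theta>)"
  let ?I = "\<lambda>g. integral {0..pi} (\<lambda>\<theta>. g (cheb_map a b (cos \<theta>)) * ?w \<theta>)"
  have w: "?w integrable_on {0..pi}"
    by (intro integrable_continuous_interval continuous_intros)
  have "(\<lambda>\<theta>. p (cheb_map a b (cos \<theta>)) * ?w \<theta>) integrable_on {0..pi}"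
    "(\<lambda>\<theta>. n (cheb_map a b (cos \<theta>)) * ?w \<theta>) integrable_on {0..pi}"
    by (intro mono_cheb_integrable assms(1) pn w)+
  then have "?I g = ?I p - ?I n"
    by (simp add: pn(3) left_diff_distrib integral_diff)
  \<comment> \<open>The triangle inequality leaves the sum of the increments of \<open>p\<close> and
    \<open>n\<close>, which is exactly the variation.\<close>
  also have "\<bar>\<dots>\<bar> \<le> (p b - p a) / j + (n b - n a) / j"
    using mono_cheb_integral_bound[OF assms(1) pn(1) assms(3)]
      mono_cheb_integral_bound[OF assms(1) pn(2) assms(3)] by linarith
  also have "\<dots> = total_variation g a b / j"
    by (simp add: pn(4) flip: add_divide_distrib)
  finally have "2 / pi * \<bar>?I g\<bar> \<le> 2 / pi * (total_variation g a b / j)"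
    by (intro mult_left_mono) auto
  then show ?thesis by (simp add: cheb_coeff_def abs_mult mult_ac)
qed

section \<open>Weak derivatives and the recurrence for Chebyshev coefficients\<close>

text \<open>Monotone functions have countably many discontinuities, and \<open>g\<close> is
  continuous wherever both Jordan parts are.\<close>

lemma bounded_variation_countable_discontinuities:
  assumes "a \<le> b" "bounded_variation g a b"
  shows "countable {x \<in> {a<..<b}. \<not> isCont g x}"
proof -
  obtain p n where pn: "mono_on {a..b} p" "mono_on {a..b} n" "\<And>x. g x = p x - n x"
    using Jordan_decomposition[OF assms(2,1)] by metis
  have "mono_on {a<..<b} p" "mono_on {a<..<b} n"
    using pn(1,2) by (auto simp: mono_on_def)
  then have "countable ({x \<in> {a<..<b}. \<not> isCont p x} \<union> {x \<in> {a<..<b}. \<not> isCont n x})"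
    by (intro countable_Un mono_on_ctble_discont_open) auto
  moreover have "isCont g x" if "isCont p x" "isCont n x" for x
    using continuous_diff[OF that] by (simp add: pn(3)[abs_def])
  ultimately show ?thesis
    by (elim countable_subset[rotated]) blast
qed

lemma weak_derivative_indefinite_integral:
  assumes "weak_derivative a b F u" "a \<le> b"
  shows "continuous_on {a..b} F" "u integrable_on {a..b}"
    and "\<And>x. x \<in> {a..b} \<Longrightarrow> F x = F a + integral {a..x} u"
proof -
  have I: "(u has_integral (F y - F x)) {x..y}" if "a \<le> x" "x \<le> y" "y \<le> b" for x y
    using assms(1) that unfolding weak_derivative_def by blast
  show int: "u integrable_on {a..b}" using I[of a b] assms(2) by auto
  show F: "F x = F a + integral {a..x} u" if "x \<in> {a..b}" for x
    using integral_unique[OF I[of a x]] that by auto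
  have "continuous_on {a..b} (\<lambda>x. F a + integral {a..x} u)"
    by (intro continuous_intros indefinite_integral_continuous_1 int)
  then show "continuous_on {a..b} F"
    by (rule continuous_on_eq) (rule F[symmetric])
qed

text \<open>Up to a constant, \<open>F\<close> is the indefinite integral of
  \<open>u\<close>.\<close>

lemma weak_derivative_has_real_derivative_at:
  assumes "weak_derivative a b F u" "x \<in> {a<..<b}" "isCont u x"
  shows "(F has_real_derivative u x) (at x)"
proof -
  have "a \<le> b" using assms(2) by simp
  note F = weak_derivative_indefinite_integral[OF assms(1) this]
  have "((\<lambda>t. F a + integral {a..t} u) has_real_derivative u x) (at x)"
    using DERIV_add[OF DERIV_const indefinite_integral_has_real_derivative_at[OF F(2) assms(2,3)]] by simp
  then show ?thesis
    by (rule has_field_derivative_transform_within_open[OF _ open_greaterThanLessThan assms(2)])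
      (rule F(3)[symmetric], simp)
qed

text \<open>The assumptions \<open>S\<close> and \<open>int\<close> hold for continuous
  \<open>u\<close> as well as for \<open>u\<close> of bounded variation, so one recurrence serves
  the intermediate derivatives and the top one.\<close>

lemma cheb_coeff_weak_derivative:
  assumes "a < b" "1 \<le> j" and weak: "weak_derivative a b F u"
    and S: "countable {x \<in> {a<..<b}. \<not> isCont u x}"
    and int: "\<And>w. continuous_on {0..pi} w \<Longrightarrow> (\<lambda>\<theta>. u (cheb_map a b (cos \<theta>)) * w \<theta>) integrable_on {0..pi}"
  shows "cheb_coeff a b F j = (b - a) / (4 * j) * (cheb_coeff a b u (j - 1) - cheb_coeff a b u (j + 1))"
proof -
  let ?g = "\<lambda>\<theta>. cheb_map a b (cos \<theta>)"
  let ?S = "{\<theta> \<in> {0..pi}. ?g \<theta> \<in> {x \<in> {a<..<b}. \<not> isCont u x}}"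
  let ?I = "\<lambda>w. integral {0..pi} (\<lambda>\<theta>. u (?g \<theta>) * w \<theta>)"
  let ?A = "\<lambda>\<theta>. F (?g \<theta>) * cos (real j * \<theta>)"
  let ?B = "\<lambda>\<theta>. u (?g \<theta>) * ((b - a) / (2 * j) * (sin \<theta> * sin (real j * \<theta>)))"
  have contF: "continuous_on {a..b} F"
    using weak_derivative_indefinite_integral[OF weak] assms(1) by simp
  have contg: "continuous_on T ?g" for T
    unfolding cheb_map_def by (intro continuous_intros)
  have derg: "(?g has_real_derivative - ((b - a) / 2 * sin \<theta>)) (at \<theta>)" for \<theta>
    unfolding cheb_map_def by (auto intro!: derivative_eq_intros)
  have contFg: "continuous_on {0..pi} (\<lambda>\<theta>. F (?g \<theta>))"
    by (rule continuous_on_compose2[OF contF contg]) (use cheb_map_in_interval assms(1) in auto)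
  have intA: "?A integrable_on {0..pi}"
    by (intro integrable_continuous_interval continuous_intros contFg)
  have intB: "?B integrable_on {0..pi}"
    by (intro int continuous_intros)
  \<comment> \<open>Each discontinuity of \<open>u\<close> comes from at most one angle, so
    countability passes to the exceptional angles \<open>?S\<close>.\<close>
  have "inj_on ?g {0..pi}"
    using assms(1) cos_inj_pi by (auto simp: inj_on_def cheb_map_def)
  then have "countable ?S" by (rule countable_image_inj_gen[OF _ S])
  \<comment> \<open>Integration by parts: \<open>?A - ?B\<close> is the derivative of
    \<open>F (?g \<theta>) * sin (real j * \<theta>) / j\<close> off \<open>?S\<close>. Both
    boundary values vanish, so \<open>?A\<close> and \<open>?B\<close> have the same
    integral.\<close>
  have "((\<lambda>\<theta>. ?A \<theta> - ?B \<theta>) has_integral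
      (F (?g pi) * sin (real j * pi) / j - F (?g 0) * sin (real j * 0) / j)) {0..pi}"
  proof (rule fundamental_theorem_of_calculus_countable[OF _ \<open>countable ?S\<close>])
    show "continuous_on {0..pi} (\<lambda>\<theta>. F (?g \<theta>) * sin (real j * \<theta>) / j)"
      using assms(2) by (intro continuous_intros contFg) auto
    show "(\<lambda>\<theta>. ?A \<theta> - ?B \<theta>) integrable_on {0..pi}"
      by (intro integrable_diff intA intB)
    fix \<theta> assume "\<theta> \<in> {0<..<pi} - ?S"
    then have \<theta>: "\<theta> \<in> {0<..<pi}" "isCont u (?g \<theta>)" "?g \<theta> \<in> {a<..<b}"
      using cheb_map_in_interior[OF assms(1)] by auto
    have derF: "(F has_real_derivative u (?g \<theta>)) (at (?g \<theta>))"
      by (rule weak_derivative_has_real_derivative_at[OF weak \<theta>(3,2)])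
    have derFg: "((\<lambda>\<theta>. F (?g \<theta>)) has_real_derivative u (?g \<theta>) * - ((b - a) / 2 * sin \<theta>)) (at \<theta>)"
      by (rule DERIV_chain2[OF derF derg])
    show "((\<lambda>\<theta>. F (?g \<theta>) * sin (real j * \<theta>) / j) has_real_derivative (?A \<theta> - ?B \<theta>)) (at \<theta>)"
      using assms(2) by (auto intro!: derivative_eq_intros derFg simp: field_simps)
    have "isCont (\<lambda>\<theta>. u (?g \<theta>)) \<theta>"
      by (rule isCont_o2[OF DERIV_isCont[OF derg] \<theta>(2)])
    moreover have "isCont (\<lambda>\<theta>. F (?g \<theta>)) \<theta>" by (rule DERIV_isCont[OF derFg])
    ultimately show "isCont (\<lambda>\<theta>. ?A \<theta> - ?B \<theta>) \<theta>"
      using assms(2) by (intro continuous_intros) auto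
  qed auto
  then have "integral {0..pi} ?A = integral {0..pi} ?B"
    using integral_diff[OF intA intB] by (simp add: integral_unique)
  \<comment> \<open>The factor 2 in the product formula turns \<open>2 * j\<close> into
    \<open>4 * j\<close>. The subtraction \<open>j - 1\<close> is exact as \<open>1 \<le> j\<close>;
    for \<open>j = 1\<close> the coefficient of order 0 enters with the same normalisation
    \<open>2 / pi\<close>.\<close>
  also have "?B = (\<lambda>\<theta>. (b - a) / (4 * j) * (u (?g \<theta>) * cos (real (j - 1) * \<theta>) - u (?g \<theta>) * cos (real (j + 1) * \<theta>)))"
  proof
    fix \<theta>
    have "cos (real (j - 1) * \<theta>) - cos (real (j + 1) * \<theta>) = 2 * (sin \<theta> * sin (real j * \<theta>))"
      using assms(2) by (simp add: of_nat_diff left_diff_distrib distrib_right cos_diff cos_add)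
    then have "u (?g \<theta>) * cos (real (j - 1) * \<theta>) - u (?g \<theta>) * cos (real (j + 1) * \<theta>)
        = u (?g \<theta>) * (2 * (sin \<theta> * sin (real j * \<theta>)))"
      by (simp only: right_diff_distrib[symmetric])
    then show "?B \<theta> = (b - a) / (4 * j) * (u (?g \<theta>) * cos (real (j - 1) * \<theta>) - u (?g \<theta>) * cos (real (j + 1) * \<theta>))"
      by (simp only:) simp
  qed
  also have "integral {0..pi} \<dots> = (b - a) / (4 * j) *
      (?I (\<lambda>\<theta>. cos (real (j - 1) * \<theta>)) - ?I (\<lambda>\<theta>. cos (real (j + 1) * \<theta>)))"
    by (subst integral_mult_right, subst integral_diff) (auto intro!: int continuous_intros)
  finally show ?thesis by (simp add: cheb_coeff_def right_diff_distrib mult_ac)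
qed

section \<open>The weights of the bound\<close>

text \<open>The product is the falling factorial of \<open>j + i\<close> with \<open>m + 1\<close>
  factors, taken over the reals so that no subtraction is truncated. All factors are positive when
  \<open>m < j\<close>.\<close>

definition cheb_weight :: "nat \<Rightarrow> nat \<Rightarrow> real" where
  "cheb_weight m j = (\<Sum>i=0..m. real (m choose i) * (1 / (\<Prod>l=0..m. real j + real i - real l)))"

text \<open>Both neighbours are brought to denominators \<open>Q i\<close> with \<open>m + 2\<close>
  factors: the products for \<open>j - 1\<close> lack the largest factor of \<open>Q i\<close>,
  those for \<open>j + 1\<close> the smallest factor of \<open>Q (Suc i)\<close>. Comparing
  numerators leaves a binomial identity.\<close>

lemma cheb_weight_recurrence:
  assumes "m + 2 \<le> j"
  shows "cheb_weight m (j - 1) + cheb_weight m (j + 1) = j * cheb_weight (Suc m) j"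
proof -
  define Q where "Q i = (\<Prod>l=0..Suc m. real j + real i - real l)" for i
  \<comment> \<open>By \<open>m + 2 \<le> j\<close>, even the smallest factor
    \<open>j - (m + 1)\<close>, at \<open>i = 0\<close>, is positive.\<close>
  have Q0: "Q i \<noteq> 0" for i
    using assms by (auto simp: Q_def)
  have reciprocal: "1 / r = c / q" if "q = c * r" "q \<noteq> 0" for q c r :: real
    using that by simp
  have down: "1 / (\<Prod>l=0..m. real (j - 1) + real i - real l) = (j + i) / Q i" for i
  proof -
    have "Q i = (real j + real i) * (\<Prod>l=0..m. real j + real i - real (Suc l))"
      unfolding Q_def by (subst prod.atLeast0_atMost_Suc_shift) simp
    also have "(\<Prod>l=0..m. real j + real i - real (Suc l)) = (\<Prod>l=0..m. real (j - 1) + real i - real l)"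
      using assms by (intro prod.cong) (auto simp: of_nat_diff)
    finally show ?thesis using reciprocal[OF _ Q0] by simp
  qed
  have up: "1 / (\<Prod>l=0..m. real (j + 1) + real i - real l) = (real j + real (Suc i) - real (Suc m)) / Q (Suc i)" for i
  proof -
    have "Q (Suc i) = (real j + real (Suc i) - real (Suc m)) * (\<Prod>l=0..m. real j + real (Suc i) - real l)"
      unfolding Q_def by (subst prod.atLeast0_atMost_Suc) (rule mult.commute)
    also have "(\<Prod>l=0..m. real j + real (Suc i) - real l) = (\<Prod>l=0..m. real (j + 1) + real i - real l)"
      by (intro prod.cong) auto
    finally show ?thesis by (rule reciprocal[OF _ Q0])
  qed
  have "cheb_weight m (j - 1) = (\<Sum>i=0..m. real (m choose i) * ((j + i) / Q i))"
    by (simp only: cheb_weight_def down)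
  \<comment> \<open>The added term has binomial coefficient zero. Splitting off \<open>i = 0\<close>
    next then aligns this sum with the one over \<open>Q (Suc i)\<close> for
    \<open>j + 1\<close>.\<close>
  also have "\<dots> = (\<Sum>i=0..Suc m. real (m choose i) * ((j + i) / Q i))"
    by simp
  also have "\<dots> = j / Q 0 + (\<Sum>i=0..m. real (m choose Suc i) * ((j + Suc i) / Q (Suc i)))"
    by (subst sum.atLeast0_atMost_Suc_shift) (simp add: add_ac)
  finally have 1: "cheb_weight m (j - 1) = \<dots>" .
  have 2: "cheb_weight m (j + 1) = (\<Sum>i=0..m. real (m choose i) * ((real j + real (Suc i) - real (Suc m)) / Q (Suc i)))"
    by (simp only: cheb_weight_def up)
  have "j * cheb_weight (Suc m) j = (\<Sum>i=0..Suc m. j * (real (Suc m choose i) / Q i))"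
    by (simp only: cheb_weight_def Q_def[symmetric] sum_distrib_left) simp
  also have "\<dots> = j / Q 0 + (\<Sum>i=0..m. j * (real (Suc m choose Suc i) / Q (Suc i)))"
    by (subst sum.atLeast0_atMost_Suc_shift) simp
  finally have 3: "j * cheb_weight (Suc m) j = \<dots>" .
  \<comment> \<open>Pascal's rule matches the multiples of \<open>j\<close>; the remaining terms
    cancel by the absorption identities.\<close>
  have coeff: "real (m choose Suc i) * (j + Suc i) + real (m choose i) * (real j + real (Suc i) - real (Suc m))
      = j * real (Suc m choose Suc i)" if "i \<le> m" for i
  proof -
    have "Suc i * (m choose Suc i) = (m - i) * (m choose i)"
      by (metis binomial_absorb_comp binomial_absorption mult.commute)
    then have "real (Suc i) * real (m choose Suc i) = (real m - real i) * real (m choose i)"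
      using that by (metis of_nat_diff of_nat_mult)
    then show ?thesis by (simp add: algebra_simps)
  qed
  have "real (m choose Suc i) * ((j + Suc i) / Q (Suc i)) +
        real (m choose i) * ((real j + real (Suc i) - real (Suc m)) / Q (Suc i))
      = j * (real (Suc m choose Suc i) / Q (Suc i))" if "i \<le> m" for i
    using coeff[OF that] by (simp only: times_divide_eq_right add_divide_distrib[symmetric])
  then show ?thesis
    unfolding 1 2 3 by (simp add: sum.distrib[symmetric] add.assoc)
qed

section \<open>Descent from the top derivative and the final bounds\<close>

text \<open>Induction on the distance \<open>m\<close> below the top derivative, each step using the
  recurrence once. The condition \<open>m + 1 \<le> j\<close> makes \<open>j - 1\<close> admissible
  for the preceding distance.\<close>

lemma cheb_coeff_kth_derivative_bound:
  assumes "a < b" and bv: "bounded_variation (D k) a b"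
    and weak: "\<And>i. i < k \<Longrightarrow> weak_derivative a b (D i) (D (Suc i))"
    and "m \<le> k" "m + 1 \<le> j"
  shows "\<bar>cheb_coeff a b (D (k - m)) j\<bar>
    \<le> 2 * total_variation (D k) a b / pi * ((b - a) / 4) ^ m * cheb_weight m j"
  using \<open>m \<le> k\<close> \<open>m + 1 \<le> j\<close>
proof (induction m arbitrary: j)
  case 0
  then show ?case
    using bounded_variation_cheb_coeff_bound[OF _ bv, of j] assms(1)
    by (simp add: cheb_weight_def field_simps)
next
  case (Suc m)
  define i where "i = k - Suc m"
  have i: "i < k" "Suc i = k - m" using Suc.prems by (auto simp: i_def)
  \<comment> \<open>The top derivative has bounded variation; every lower one has a weak derivative
    itself and is therefore continuous.\<close>
  have "countable {x \<in> {a<..<b}. \<not> isCont (D (Suc i)) x} \<and>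
    (\<forall>w. continuous_on {0..pi} w \<longrightarrow>
      (\<lambda>\<theta>. D (Suc i) (cheb_map a b (cos \<theta>)) * w \<theta>) integrable_on {0..pi})"
  proof (cases "Suc i = k")
    case True
    then show ?thesis
      using bounded_variation_countable_discontinuities[OF _ bv]
        bounded_variation_cheb_integrable[OF _ bv] assms(1)
      by (auto intro: integrable_continuous_interval)
  next
    case False
    then have c: "continuous_on {a..b} (D (Suc i))"
      using weak_derivative_indefinite_integral(1)[OF weak[of "Suc i"]] i assms(1) by auto
    have g: "continuous_on {0..pi} (\<lambda>\<theta>. D (Suc i) (cheb_map a b (cos \<theta>)))"
      by (rule continuous_on_compose2[OF c])
        (use cheb_map_in_interval assms(1) in \<open>auto simp: cheb_map_def intro!: continuous_intros\<close>)
    have e: "{x \<in> {a<..<b}. \<not> isCont (D (Suc i)) x} = {}"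
      using continuous_on_interior[OF c] by auto
    show ?thesis
      unfolding e by (auto intro!: integrable_continuous_interval continuous_intros g)
  qed
  then have rec: "cheb_coeff a b (D i) j = (b - a) / (4 * j) *
      (cheb_coeff a b (D (Suc i)) (j - 1) - cheb_coeff a b (D (Suc i)) (j + 1))"
    using Suc.prems by (intro cheb_coeff_weak_derivative assms(1) weak i) auto
  let ?C = "2 * total_variation (D k) a b / pi * ((b - a) / 4) ^ m"
  have "\<bar>cheb_coeff a b (D i) j\<bar> \<le> (b - a) / (4 * j) *
      (\<bar>cheb_coeff a b (D (Suc i)) (j - 1)\<bar> + \<bar>cheb_coeff a b (D (Suc i)) (j + 1)\<bar>)"
    unfolding rec abs_mult using assms(1) by (intro mult_mono) auto
  also have "\<dots> \<le> (b - a) / (4 * j) * (?C * cheb_weight m (j - 1) + ?C * cheb_weight m (j + 1))"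
    using Suc.IH[of "j - 1"] Suc.IH[of "j + 1"] Suc.prems assms(1) i
    by (intro mult_left_mono add_mono) auto
  also have "\<dots> = (b - a) / (4 * j) * (?C * (j * cheb_weight (Suc m) j))"
    using cheb_weight_recurrence[of m j] Suc.prems by (simp only: distrib_left[symmetric])
  \<comment> \<open>The factor \<open>j\<close> from the weight recurrence cancels, leaving one more
    power of \<open>(b - a) / 4\<close>.\<close>
  also have "\<dots> = 2 * total_variation (D k) a b / pi * ((b - a) / 4) ^ Suc m * cheb_weight (Suc m) j"
    using Suc.prems by simp
  finally show ?case by (simp add: i_def)
qed

theorem theorem3p2:
  fixes a b :: real and k :: nat and f fk :: "real \<Rightarrow> real"
  assumes "a < b"
    and "kth_derivative a b k f fk"
    and "bounded_variation fk a b"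
  shows "(\<forall>j::nat. 1 \<le> j \<longrightarrow>
            \<bar>cheb_coeff a b fk j\<bar> \<le> 2 * total_variation fk a b / (real j * pi)) \<and>
         (\<forall>j::nat. k + 1 \<le> j \<longrightarrow>
            \<bar>cheb_coeff a b f j\<bar> \<le> 2 * total_variation fk a b / pi * ((b - a) / 4) ^ k *
              (\<Sum>i=0..k. real (k choose i) * (1 / (\<Prod>m=0..k. real j + real i - real m))))"
proof -
  from assms(2) obtain D where "(\<forall>x\<in>{a..b}. D 0 x = f x) \<and> (\<forall>x\<in>{a..b}. D k x = fk x) \<and>
      (\<forall>i<k. weak_derivative a b (D i) (D (Suc i)))"
    unfolding kth_derivative_def ..
  then have D: "\<And>x. x \<in> {a..b} \<Longrightarrow> D 0 x = f x" "\<And>x. x \<in> {a..b} \<Longrightarrow> D k x = fk x"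
    and weak: "\<And>i. i < k \<Longrightarrow> weak_derivative a b (D i) (D (Suc i))"
    by simp_all
  \<comment> \<open>\<open>D k\<close> and \<open>fk\<close> are known to agree on
    \<open>{a..b}\<close> only, so the variation is carried over explicitly.\<close>
  have vs: "variation_sums (D k) a b = variation_sums fk a b"
    by (rule variation_sums_cong) (rule D(2))
  have bv: "bounded_variation (D k) a b" and tv: "total_variation (D k) a b = total_variation fk a b"
    using assms(3) by (simp_all add: bounded_variation_def total_variation_def vs)
  \<comment> \<open>The full descent \<open>m = k\<close> reaches \<open>D 0\<close>, which has the
    same coefficients as \<open>f\<close>.\<close>
  have "\<bar>cheb_coeff a b f j\<bar>
      \<le> 2 * total_variation fk a b / pi * ((b - a) / 4) ^ k * cheb_weight k j" if "k + 1 \<le> j" for j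
    using cheb_coeff_kth_derivative_bound[of a b D k k j, OF assms(1) bv weak order_refl that]
      cheb_coeff_cong[of a b "D 0" f j] D(1) assms(1) tv by simp
  then show ?thesis
    using bounded_variation_cheb_coeff_bound[OF _ assms(3)] assms(1)
    by (simp add: cheb_weight_def)
qed

end
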